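(* Let $n\ge 3$ and let $\mathfrak{g}$ be the $n$-dimensional filiform Lie algebra $L_n$ over $\mathbb{C}$. Then there exist faithful finite-dimensional $\mathfrak{g}$-modules which are not nilpotent.
   Context: $L_n$ is the $n$-dimensional Lie algebra with basis $X_1,\dots,X_n$ and brackets $[X_1,X_i]=X_{i+1}$ for $i\in\{2,\dots,n-1\}$, all other brackets $[X_i,X_j]$ with $i<j$ being zero. An $n$-dimensional nilpotent Lie algebra is called filiform if the smallest $k$ with $\mathcal{C}^k\mathfrak{g}=\{0\}$ equals $n-1$, where $\mathcal{C}^0\mathfrak{g}=\mathfrak{g}$ and $\mathcal{C}^{k+1}\mathfrak{g}=[\mathfrak{g},\mathcal{C}^k\mathfrak{g}]$. A $\mathfrak{g}$-module is a vector space $M$ together with a linear representation $\rho:\mathfrak{g}\to \mathrm{End}(M)$. It is faithful if $\rho$ is injective. It is nilpotent if the endomorphism $\rho(X)$ is nilpotent for every $X\in\mathfrak{g}$. *)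

theory Defs
  imports Complex_Main "HOL-Library.Function_Algebras" "HOL-Library.FuncSet"
begin

text \<open>
  Lie algebras and modules have explicit carriers: each is a subspace of an ambient vector space,
  and the bracket and the action are constrained on the carriers only.
\<close>

definition fin_dim :: "('k::field \<Rightarrow> 'a::ab_group_add \<Rightarrow> 'a) \<Rightarrow> 'a set \<Rightarrow> bool" where
  "fin_dim scale V \<longleftrightarrow> (\<exists>B. finite B \<and> module.span scale B = V)"

locale lie_algebra = vector_space scale
  for scale :: "'k::field \<Rightarrow> 'a::ab_group_add \<Rightarrow> 'a" +
  fixes g :: "'a set" and bracket :: "'a \<Rightarrow> 'a \<Rightarrow> 'a"
  assumes subspace_g: "subspace g"
    and bracket_closed: "\<lbrakk>x \<in> g; y \<in> g\<rbrakk> \<Longrightarrow> bracket x y \<in> g"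
    and bracket_add_left:
      "\<lbrakk>x \<in> g; y \<in> g; z \<in> g\<rbrakk> \<Longrightarrow> bracket (x + y) z = bracket x z + bracket y z"
    and bracket_add_right:
      "\<lbrakk>x \<in> g; y \<in> g; z \<in> g\<rbrakk> \<Longrightarrow> bracket x (y + z) = bracket x y + bracket x z"
    and bracket_scale_left:
      "\<lbrakk>x \<in> g; y \<in> g\<rbrakk> \<Longrightarrow> bracket (scale c x) y = scale c (bracket x y)"
    and bracket_scale_right:
      "\<lbrakk>x \<in> g; y \<in> g\<rbrakk> \<Longrightarrow> bracket x (scale c y) = scale c (bracket x y)"
    and bracket_self: "x \<in> g \<Longrightarrow> bracket x x = 0"
    and jacobi: "\<lbrakk>x \<in> g; y \<in> g; z \<in> g\<rbrakk> \<Longrightarrow>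
      bracket x (bracket y z) + bracket y (bracket z x) + bracket z (bracket x y) = 0"
begin

fun lower_central :: "nat \<Rightarrow> 'a set" where
  "lower_central 0 = g"
| "lower_central (Suc k) = span {bracket x y |x y. x \<in> g \<and> y \<in> lower_central k}"

definition filiform :: bool where
  "filiform \<longleftrightarrow> fin_dim scale g \<and> (\<exists>k. lower_central k = {0}) \<and>
     (LEAST k. lower_central k = {0}) = dim g - 1"

end

locale lie_algebra_L = lie_algebra scale g bracket
  for scale :: "complex \<Rightarrow> 'a::ab_group_add \<Rightarrow> 'a" and g bracket +
  fixes n :: nat and X :: "nat \<Rightarrow> 'a"
  assumes inj_X: "inj_on X {1..n}"
    and independent_X: "independent (X ` {1..n})"
    and span_X: "span (X ` {1..n}) = g"
    and bracket_X1: "i \<in> {2..n - 1} \<Longrightarrow> bracket (X 1) (X i) = X (i + 1)"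
    and bracket_X_zero: "\<lbrakk>1 \<le> i; i < j; j \<le> n; \<not> (i = 1 \<and> j \<in> {2..n - 1})\<rbrakk> \<Longrightarrow>
      bracket (X i) (X j) = 0"

locale lie_module = lie_algebra scale g bracket + M: vector_space scaleM
  for scale :: "'k::field \<Rightarrow> 'a::ab_group_add \<Rightarrow> 'a" and g bracket
    and scaleM :: "'k \<Rightarrow> 'b::ab_group_add \<Rightarrow> 'b" +
  fixes M :: "'b set" and \<rho> :: "'a \<Rightarrow> 'b \<Rightarrow> 'b"
  assumes subspace_M: "M.subspace M"
    and rep_closed: "\<lbrakk>x \<in> g; v \<in> M\<rbrakk> \<Longrightarrow> \<rho> x v \<in> M"
    and rep_add_right: "\<lbrakk>x \<in> g; v \<in> M; w \<in> M\<rbrakk> \<Longrightarrow> \<rho> x (v + w) = \<rho> x v + \<rho> x w"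
    and rep_scale_right: "\<lbrakk>x \<in> g; v \<in> M\<rbrakk> \<Longrightarrow> \<rho> x (scaleM c v) = scaleM c (\<rho> x v)"
    and rep_add_left: "\<lbrakk>x \<in> g; y \<in> g; v \<in> M\<rbrakk> \<Longrightarrow> \<rho> (x + y) v = \<rho> x v + \<rho> y v"
    and rep_scale_left: "\<lbrakk>x \<in> g; v \<in> M\<rbrakk> \<Longrightarrow> \<rho> (scale c x) v = scaleM c (\<rho> x v)"
    and rep_bracket: "\<lbrakk>x \<in> g; y \<in> g; v \<in> M\<rbrakk> \<Longrightarrow>
      \<rho> (bracket x y) v = \<rho> x (\<rho> y v) - \<rho> y (\<rho> x v)"

text \<open>Two elements act by the same endomorphism when their actions agree on the carrier
  of the module; hence the restriction.\<close>

definition faithful_module :: "'a set \<Rightarrow> 'b set \<Rightarrow> ('a \<Rightarrow> 'b \<Rightarrow> 'b) \<Rightarrow> bool" where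
  "faithful_module g M \<rho> \<longleftrightarrow> inj_on (\<lambda>x. restrict (\<rho> x) M) g"

definition nilpotent_module :: "'a set \<Rightarrow> 'b::zero set \<Rightarrow> ('a \<Rightarrow> 'b \<Rightarrow> 'b) \<Rightarrow> bool" where
  "nilpotent_module g M \<rho> \<longleftrightarrow> (\<forall>x\<in>g. \<exists>k. \<forall>v\<in>M. (\<rho> x ^^ k) v = 0)"

text \<open>
  The space of complex sequences contains a copy of every finite-dimensional complex vector
  space, so its subspaces serve as the possible module carriers.
\<close>

definition seq_scale :: "complex \<Rightarrow> (nat \<Rightarrow> complex) \<Rightarrow> nat \<Rightarrow> complex" where
  "seq_scale c f = (\<lambda>i. c * f i)"

lemma vector_space_seq: "vector_space seq_scale"
  by unfold_locales (auto simp: seq_scale_def fun_eq_iff algebra_simps)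


text \<open>The algebras singled out by \<^locale>\<open>lie_algebra_L\<close> are indeed filiform, and they exist for all n.\<close>

context lie_algebra
begin

lemma bracket_zero_left: "y \<in> g \<Longrightarrow> bracket 0 y = 0"
  using bracket_add_left[of 0 0 y] subspace_0[OF subspace_g] by simp

lemma bracket_zero_right: "x \<in> g \<Longrightarrow> bracket x 0 = 0"
  using bracket_add_right[of x 0 0] subspace_0[OF subspace_g] by simp

lemma bracket_swap:
  assumes "x \<in> g" "y \<in> g"
  shows "bracket x y = - bracket y x"
proof -
  have "x + y \<in> g" using assms subspace_add subspace_g by blast
  then have "0 = bracket (x + y) (x + y)" by (simp add: bracket_self)
  also have "\<dots> = bracket x y + bracket y x"
    using assms \<open>x + y \<in> g\<close>
    by (simp add: bracket_add_left bracket_add_right bracket_self[OF assms(1)] bracket_self[OF assms(2)])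
  finally show ?thesis by (simp add: eq_neg_iff_add_eq_0)
qed

lemma bracket_span_subset:
  assumes S: "subspace S" and A: "A \<subseteq> g" and B: "B \<subseteq> g"
    and AB: "\<And>x y. x \<in> A \<Longrightarrow> y \<in> B \<Longrightarrow> bracket x y \<in> S"
    and x: "x \<in> span A" and y: "y \<in> span B"
  shows "bracket x y \<in> S"
proof -
  have "subspace {x \<in> g. \<forall>b\<in>B. bracket x b \<in> S}"
    using B by (intro subspaceI)
      (auto simp: bracket_zero_left bracket_add_left bracket_scale_left subset_iff
        subspace_0[OF S] subspace_add[OF S] subspace_scale[OF S]
        subspace_0[OF subspace_g] subspace_add[OF subspace_g] subspace_scale[OF subspace_g])
  from span_minimal[OF _ this, of A] have x': "x \<in> g" "\<And>b. b \<in> B \<Longrightarrow> bracket x b \<in> S"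
    using A AB x by blast+
  have "subspace {y \<in> g. bracket x y \<in> S}"
    using x' by (intro subspaceI)
      (auto simp: bracket_zero_right bracket_add_right bracket_scale_right
        subspace_0[OF S] subspace_add[OF S] subspace_scale[OF S]
        subspace_0[OF subspace_g] subspace_add[OF subspace_g] subspace_scale[OF subspace_g])
  from span_minimal[OF _ this, of B] show ?thesis using B x' y by blast
qed

end

context lie_algebra_L
begin

lemma X_in: "i \<in> {1..n} \<Longrightarrow> X i \<in> g"
  using span_X span_base by blast

lemma bracket_span_tail:
  assumes m: "1 \<le> m"
  shows "span {bracket x y |x y. x \<in> g \<and> y \<in> span (X ` {m..n})} = span (X ` {max m 2 + 1..n})"
    (is "span ?A = span ?B")
proof (rule subset_antisym)
  have XX: "bracket (X i) (X j) \<in> span ?B" if i: "i \<in> {1..n}" and j: "j \<in> {m..n}" for i j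
  proof -
    have gen: "X (k + 1) \<in> span ?B" if "k \<in> {2..n - 1}" "m \<le> k" for k
      using that by (intro span_base imageI) auto
    have jn: "j \<in> {1..n}" using j m by auto
    consider "i = j" | "i < j" "i = 1" "j \<in> {2..n - 1}" | "i < j" "\<not> (i = 1 \<and> j \<in> {2..n - 1})"
      | "j < i" "j = 1" "i \<in> {2..n - 1}" | "j < i" "\<not> (j = 1 \<and> i \<in> {2..n - 1})"
      by linarith
    then show ?thesis
    proof cases
      case 1 then show ?thesis by (simp add: bracket_self X_in[OF jn] span_zero)
    next
      case 2 then show ?thesis using bracket_X1[of j] gen[of j] j by simp
    next
      case 3 then show ?thesis using bracket_X_zero[of i j] i j by (simp add: span_zero)
    next
      case 4
      then have "X (i + 1) \<in> span ?B" using j by (intro gen) auto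
      then show ?thesis
        using 4 bracket_swap[OF X_in[OF i] X_in[OF jn]] bracket_X1[of i] by (simp add: span_neg)
    next
      case 5
      then show ?thesis
        using bracket_swap[OF X_in[OF i] X_in[OF jn]] bracket_X_zero[of j i] i jn
        by (simp add: span_zero)
    qed
  qed
  have "?A \<subseteq> span ?B"
  proof clarify
    fix x y assume "x \<in> g" "y \<in> span (X ` {m..n})"
    moreover have "X ` {1..n} \<subseteq> g" "X ` {m..n} \<subseteq> g" using X_in m by force+
    ultimately show "bracket x y \<in> span ?B"
      using bracket_span_subset[of "span ?B" "X ` {1..n}" "X ` {m..n}" x y] XX span_X
        subspace_span by blast
  qed
  then show "span ?A \<subseteq> span ?B" by (rule span_minimal) simp
next
  have "?B \<subseteq> ?A"
  proof clarify
    fix i assume i: "i \<in> {max m 2 + 1..n}"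
    then have "i - 1 \<in> {2..n - 1}" "i - 1 + 1 = i" by auto
    then have "X i = bracket (X 1) (X (i - 1))" using bracket_X1[of "i - 1"] by simp
    moreover have "X 1 \<in> g" using i by (intro X_in) auto
    moreover have "X (i - 1) \<in> span (X ` {m..n})" using i by (intro span_base imageI) auto
    ultimately show "\<exists>x y. X i = bracket x y \<and> x \<in> g \<and> y \<in> span (X ` {m..n})" by blast
  qed
  then show "span ?B \<subseteq> span ?A" by (rule span_mono)
qed

lemma lower_central_Suc: "lower_central (Suc k) = span (X ` {k + 3..n})"
proof (induction k)
  case 0
  show ?case using bracket_span_tail[of 1] by (simp add: span_X[simplified] numeral_3_eq_3)
next
  case (Suc k)
  then show ?case using bracket_span_tail[of "k + 3"] by (simp add: numeral_3_eq_3)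
qed

lemma filiform_L:
  assumes n: "n \<ge> 3"
  shows filiform
proof -
  have last: "X n \<noteq> 0" using independent_X dependent_zero[of "X ` {1..n}"] n by auto
  have zero: "lower_central (n - 1) = {0}"
    using lower_central_Suc[of "n - 2"] n by (simp add: Suc_diff_Suc numeral_2_eq_2)
  have nonzero: "lower_central k \<noteq> {0}" if "k < n - 1" for k
  proof -
    have "X n \<in> lower_central k"
      using that n X_in[of n] by (cases k) (auto simp: lower_central_Suc simp del: lower_central.simps(2)
          intro!: span_base imageI)
    then show ?thesis using last by auto
  qed
  have "dim g = n"
    using dim_eq_card_independent[OF independent_X] dim_span[of "X ` {1..n}"] card_image[OF inj_X]
    by (simp only: span_X) simp
  moreover have "(LEAST k. lower_central k = {0}) = n - 1"
    using zero nonzero by (intro Least_equality) (auto simp: not_less[symmetric])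
  moreover have "fin_dim scale g" unfolding fin_dim_def using span_X by blast
  ultimately show ?thesis unfolding filiform_def using zero by auto
qed

end

lemma lie_algebra_L_exists:
  "\<exists>g bracket X. lie_algebra_L seq_scale g bracket n X"
proof -
  interpret vector_space seq_scale by (rule vector_space_seq)
  define g :: "(nat \<Rightarrow> complex) set" where "g = {f. \<forall>i. i \<notin> {1..n} \<longrightarrow> f i = 0}"
  define br :: "(nat \<Rightarrow> complex) \<Rightarrow> (nat \<Rightarrow> complex) \<Rightarrow> nat \<Rightarrow> complex"
    where "br f h = (\<lambda>k. if k \<in> {3..n} then f 1 * h (k - 1) - h 1 * f (k - 1) else 0)" for f h
  define X :: "nat \<Rightarrow> nat \<Rightarrow> complex" where "X i = (\<lambda>k. if k = i then 1 else 0)" for i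
  have g: "subspace g" by (intro subspaceI) (auto simp: g_def seq_scale_def)
  have inj: "inj X" by (auto simp: X_def inj_on_def fun_eq_iff split: if_splits)
  have comb: "(\<Sum>v\<in>X ` A. seq_scale (u v) v) k = (if k \<in> A then u (X k) else 0)"
    if "finite A" for A u k
  proof -
    have "(\<Sum>v\<in>X ` A. seq_scale (u v) v) k = (\<Sum>i\<in>A. seq_scale (u (X i)) (X i)) k"
      using inj by (subst sum.reindex) (auto intro: inj_on_subset)
    also have "\<dots> = (\<Sum>i\<in>A. seq_scale (u (X i)) (X i) k)"
      using that by (induction A rule: finite_induct) auto
    also have "\<dots> = (\<Sum>i\<in>A. if i = k then u (X i) else 0)"
      by (intro sum.cong) (auto simp: seq_scale_def X_def)
    finally show ?thesis using that by simp
  qed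
  have "independent (X ` {1..n})"
  proof (rule independent_if_scalars_zero)
    fix u x assume "(\<Sum>v\<in>X ` {1..n}. seq_scale (u v) v) = 0" "x \<in> X ` {1..n}"
    then obtain i where "x = X i" "i \<in> {1..n}" by blast
    then show "u x = 0"
      using comb[of "{1..n}" u i] \<open>(\<Sum>v\<in>X ` {1..n}. seq_scale (u v) v) = 0\<close> by simp
  qed simp
  moreover have "span (X ` {1..n}) = g"
  proof (rule subset_antisym)
    show "span (X ` {1..n}) \<subseteq> g" using g by (intro span_minimal) (auto simp: g_def X_def)
    show "g \<subseteq> span (X ` {1..n})"
    proof
      fix f assume "f \<in> g"
      then have "f = (\<Sum>v\<in>X ` {1..n}. seq_scale (f (inv X v)) v)"
        using comb[of "{1..n}" "\<lambda>v. f (inv X v)"] inj by (auto simp: fun_eq_iff g_def)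
      also have "\<dots> \<in> span (X ` {1..n})" by (intro span_sum span_scale span_base)
      finally show "f \<in> span (X ` {1..n})" .
    qed
  qed
  moreover have "br (X 1) (X i) = X (i + 1)" if "i \<in> {2..n - 1}" for i
    using that by (auto simp: br_def X_def fun_eq_iff)
  moreover have "br (X i) (X j) = 0" if "1 \<le> i" "i < j" "j \<le> n" "\<not> (i = 1 \<and> j \<in> {2..n - 1})" for i j
    using that by (auto simp: br_def X_def fun_eq_iff)
  moreover have "br x (br y z) + br y (br z x) + br z (br x y) = 0" for x y z
  proof
    fix k
    have zero: "br f h j = 0" if "j \<notin> {3..n}" for f h j using that by (auto simp: br_def)
    have br: "br f h j = f 1 * h (j - 1) - h 1 * f (j - 1)" if "j \<in> {3..n}" for f h j
      using that by (simp add: br_def)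
    consider "k \<in> {4..n}" | "k = 3" "k \<in> {3..n}" | "k \<notin> {3..n}" by force
    then show "(br x (br y z) + br y (br z x) + br z (br x y)) k = 0 k"
    proof cases
      case 1
      then have "k \<in> {3..n}" "k - 1 \<in> {3..n}" by auto
      then show ?thesis
        by (simp only: plus_fun_apply zero_fun_apply br) (simp add: zero algebra_simps)
    next
      case 2
      then show ?thesis by (simp add: br zero)
    next
      case 3
      then show ?thesis by (simp only: plus_fun_apply zero_fun_apply zero[OF 3]) simp
    qed
  qed
  moreover have "br (x + y) z = br x z + br y z" "br x (y + z) = br x y + br x z"
    "br (seq_scale c x) y = seq_scale c (br x y)" "br x (seq_scale c y) = seq_scale c (br x y)"
    "br x x = 0" for x y z c
    by (rule ext, simp add: br_def seq_scale_def algebra_simps)+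
  moreover have "br x y \<in> g" for x y by (simp add: g_def br_def)
  moreover have "inj_on X {1..n}" using inj by (rule inj_on_subset) simp
  ultimately have "lie_algebra_L seq_scale g br n X"
    using g by unfold_locales blast+
  then show ?thesis by blast
qed

end

theory Submission
  imports Defs
begin

text \<open>
  On a space with basis \<open>e\<^sub>0, \<dots>, e\<^sub>n\<close> let \<open>X\<^sub>i e\<^sub>0 = e\<^sub>i\<close> for \<open>i \<ge> 2\<close>, let \<open>X\<^sub>1\<close> shift
  \<open>e\<^sub>2 \<mapsto> e\<^sub>3 \<mapsto> \<dots> \<mapsto> e\<^sub>n \<mapsto> 0\<close> and kill \<open>e\<^sub>0\<close>, and let all other \<open>X\<^sub>i e\<^sub>j\<close> with \<open>j \<noteq> 1\<close> be zero.
  The line spanned by \<open>e\<^sub>1\<close> is a direct summand on which \<open>\<frak>g\<close> acts by the character with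
  \<open>X\<^sub>1 e\<^sub>1 = e\<^sub>1\<close> and \<open>X\<^sub>i e\<^sub>1 = 0\<close> for \<open>i \<ge> 2\<close>; it makes the module non-nilpotent.
  The coordinates of an element of \<open>\<frak>g\<close> are read off from its action on \<open>e\<^sub>0\<close> and \<open>e\<^sub>1\<close>.
\<close>

definition finite_seqs :: "nat \<Rightarrow> (nat \<Rightarrow> complex) set" where
  "finite_seqs n = {f. \<forall>i>n. f i = 0}"

definition unit_seq :: "nat \<Rightarrow> nat \<Rightarrow> complex" where
  "unit_seq j = (\<lambda>i. if i = j then 1 else 0)"

lemma unit_seq_in: "j \<le> n \<Longrightarrow> unit_seq j \<in> finite_seqs n"
  by (simp add: finite_seqs_def unit_seq_def)

lemma subspace_finite_seqs: "module.subspace seq_scale (finite_seqs n)"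
proof -
  interpret vector_space seq_scale by (rule vector_space_seq)
  show ?thesis by (intro subspaceI) (auto simp: finite_seqs_def seq_scale_def)
qed

lemma fin_dim_finite_seqs: "fin_dim seq_scale (finite_seqs n)"
proof -
  interpret vector_space seq_scale by (rule vector_space_seq)
  have "span (unit_seq ` {..n}) = finite_seqs n"
  proof (rule subset_antisym)
    show "span (unit_seq ` {..n}) \<subseteq> finite_seqs n"
      by (intro span_minimal subspace_finite_seqs) (auto simp: unit_seq_in)
    show "finite_seqs n \<subseteq> span (unit_seq ` {..n})"
    proof
      fix f assume f: "f \<in> finite_seqs n"
      have eval: "(\<Sum>j\<in>A. seq_scale (f j) (unit_seq j)) i = (\<Sum>j\<in>A. seq_scale (f j) (unit_seq j) i)"
        if "finite A" for A i using that by (induction A rule: finite_induct) auto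
      have "f = (\<Sum>j\<le>n. seq_scale (f j) (unit_seq j))"
        using f by (intro ext, subst eval)
          (auto simp: seq_scale_def unit_seq_def finite_seqs_def if_distrib cong: if_cong)
      also have "\<dots> \<in> span (unit_seq ` {..n})"
        by (intro span_sum span_scale span_base) auto
      finally show "f \<in> span (unit_seq ` {..n})" .
    qed
  qed
  then show ?thesis unfolding fin_dim_def by blast
qed

context lie_algebra_L
begin

text \<open>Meaningful only for \<open>i\<close> in \<open>{1..n}\<close>: outside this range
  nothing constrains \<open>X i\<close>, which may even repeat a basis vector.\<close>

definition coord :: "nat \<Rightarrow> 'a \<Rightarrow> complex" where
  "coord i x = representation (X ` {1..n}) x (X i)"

lemma in_span_X: "x \<in> g \<Longrightarrow> x \<in> span (X ` {1..n})"
  by (simp only: span_X)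

lemma coord_add: "x \<in> g \<Longrightarrow> y \<in> g \<Longrightarrow> coord i (x + y) = coord i x + coord i y"
  unfolding coord_def by (simp only: representation_add[OF independent_X in_span_X in_span_X])

lemma coord_scale: "x \<in> g \<Longrightarrow> coord i (scale c x) = c * coord i x"
  unfolding coord_def by (simp only: representation_scale[OF independent_X in_span_X])

lemma coord_zero: "coord i 0 = 0"
  by (simp add: coord_def representation_zero)

lemma coord_uminus: "x \<in> g \<Longrightarrow> coord i (- x) = - coord i x"
  using coord_scale[of x i "- 1"] by simp

lemma coord_X: "i \<in> {1..n} \<Longrightarrow> j \<in> {1..n} \<Longrightarrow> coord i (X j) = (if i = j then 1 else 0)"
  unfolding coord_def
  by (simp only: representation_basis[OF independent_X imageI] inj_on_eq_iff[OF inj_X])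

lemma coord_eqI:
  assumes "x \<in> g" "y \<in> g" "\<And>i. i \<in> {1..n} \<Longrightarrow> coord i x = coord i y"
  shows "x = y"
proof -
  have eq: "z = (\<Sum>v\<in>X ` {1..n}. scale (representation (X ` {1..n}) z v) v)" if "z \<in> g" for z
    by (rule sum_representation_eq[OF independent_X in_span_X[OF that], symmetric]) simp_all
  have "x = (\<Sum>v\<in>X ` {1..n}. scale (representation (X ` {1..n}) x v) v)"
    by (rule eq[OF assms(1)])
  also have "\<dots> = (\<Sum>v\<in>X ` {1..n}. scale (representation (X ` {1..n}) y v) v)"
    using assms(3) unfolding coord_def by (intro sum.cong refl) auto
  also have "\<dots> = y" by (rule eq[OF assms(2), symmetric])
  finally show ?thesis .
qed

text \<open>For \<open>i < j\<close> the defining brackets give this directly, both sides vanish for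
  \<open>i = j\<close>, and both change sign when \<open>i\<close> and \<open>j\<close> are
  exchanged. The guard \<open>k \<ge> 3\<close> keeps \<open>k - 1\<close> among the indices from 2
  on, the vectors that \<open>X 1\<close> shifts.\<close>

lemma coord_bracket_X:
  assumes i: "i \<in> {1..n}" and j: "j \<in> {1..n}" and k: "k \<in> {1..n}"
  shows "coord k (bracket (X i) (X j)) =
    (if k \<ge> 3 then coord 1 (X i) * coord (k - 1) (X j) - coord 1 (X j) * coord (k - 1) (X i) else 0)"
proof -
  have pred: "coord (k - 1) (X m) = (if k - 1 = m then 1 else 0)" if "k \<ge> 3" "m \<in> {1..n}" for m
    using that k by (intro coord_X) auto
  have less: "coord k (bracket (X i) (X j)) =
    (if k \<ge> 3 then coord 1 (X i) * coord (k - 1) (X j) - coord 1 (X j) * coord (k - 1) (X i) else 0)"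
    if "i < j" "i \<in> {1..n}" "j \<in> {1..n}" for i j
  proof (cases "i = 1 \<and> j \<in> {2..n - 1}")
    case True
    then have "coord k (bracket (X i) (X j)) = coord k (X (j + 1))"
      using bracket_X1[of j] by simp
    then show ?thesis using True k that pred by (auto simp: coord_X)
  next
    case False
    then show ?thesis using bracket_X_zero[of i j] that k pred
      by (auto simp: coord_X coord_zero)
  qed
  consider "i < j" | "i = j" | "j < i" by linarith
  then show ?thesis
  proof cases
    case 1 then show ?thesis using less i j by blast
  next
    case 2 then show ?thesis using X_in[OF j] by (simp add: bracket_self coord_zero)
  next
    case 3
    have "coord k (bracket (X i) (X j)) = - coord k (bracket (X j) (X i))"
      using bracket_swap[OF X_in[OF i] X_in[OF j]]
        coord_uminus[OF bracket_closed[OF X_in[OF j] X_in[OF i]]] by simp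
    then show ?thesis using less[OF 3 j i] by simp
  qed
qed

text \<open>Both sides are bilinear. For a basis vector on the left, the good \<open>y\<close> form
  a subspace containing the basis; then for fixed \<open>y\<close> the good \<open>x\<close> do
  too.\<close>

lemma coord_bracket:
  assumes x: "x \<in> g" and y: "y \<in> g" and k: "k \<in> {1..n}"
  shows "coord k (bracket x y) =
    (if k \<ge> 3 then coord 1 x * coord (k - 1) y - coord 1 y * coord (k - 1) x else 0)"
proof -
  let ?P = "\<lambda>x y. coord k (bracket x y) =
    (if k \<ge> 3 then coord 1 x * coord (k - 1) y - coord 1 y * coord (k - 1) x else 0)"
  have base: "?P (X i) y" if i: "i \<in> {1..n}" and y: "y \<in> g" for i y
  proof -
    have "subspace {y \<in> g. ?P (X i) y}"
      by (intro subspaceI)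
        (auto simp: X_in[OF i] bracket_zero_right bracket_add_right bracket_scale_right
          coord_zero coord_add coord_scale bracket_closed algebra_simps
          subspace_0[OF subspace_g] subspace_add[OF subspace_g] subspace_scale[OF subspace_g])
    moreover have "X ` {1..n} \<subseteq> {y \<in> g. ?P (X i) y}"
      using coord_bracket_X[OF i _ k] X_in by blast
    ultimately show ?thesis using span_minimal[of "X ` {1..n}" "{y \<in> g. ?P (X i) y}"] y span_X
      by blast
  qed
  have "subspace {x \<in> g. ?P x y}"
    by (intro subspaceI)
      (auto simp: y bracket_zero_left bracket_add_left bracket_scale_left
        coord_zero coord_add coord_scale bracket_closed algebra_simps
        subspace_0[OF subspace_g] subspace_add[OF subspace_g] subspace_scale[OF subspace_g])
  moreover have "X ` {1..n} \<subseteq> {x \<in> g. ?P x y}"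
    using base[OF _ y] X_in by blast
  ultimately show ?thesis using span_minimal[of "X ` {1..n}" "{x \<in> g. ?P x y}"] x span_X
    by blast
qed

text \<open>Away from coordinate 1 this is the affine action on the abelian ideal spanned by
  \<open>X 2\<close>, ..., \<open>X n\<close>: \<open>coord 1 x\<close> times the adjoint action of
  \<open>X 1\<close>, plus translation by the ideal part of \<open>x\<close>. Coordinate 0 is the
  homogenizing one.\<close>

definition rep :: "'a \<Rightarrow> (nat \<Rightarrow> complex) \<Rightarrow> nat \<Rightarrow> complex" where
  "rep x f k =
    (if k = 1 then coord 1 x * f 1
     else if k = 2 then coord 2 x * f 0
     else if k \<in> {3..n} then coord k x * f 0 + coord 1 x * f (k - 1)
     else 0)"

text \<open>Coordinate 0 of every image is zero, so a product of two actions keeps only one mixed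
  term with \<open>f 0\<close> and a double shift. The double shifts are symmetric in
  \<open>x\<close> and \<open>y\<close> and cancel; the mixed terms give
  \<open>coord_bracket\<close>. On coordinate 1 the actions are scalars and commute.\<close>

lemma rep_bracket_commutator:
  assumes n: "n \<ge> 2" and x: "x \<in> g" and y: "y \<in> g"
  shows "rep (bracket x y) f = rep x (rep y f) - rep y (rep x f)"
proof
  fix k
  have low: "coord 1 (bracket x y) = 0" "coord 2 (bracket x y) = 0"
    using n coord_bracket[OF x y, of 1] coord_bracket[OF x y, of 2] by simp_all
  have high: "coord k (bracket x y) = coord 1 x * coord (k - 1) y - coord 1 y * coord (k - 1) x"
    if "k \<in> {3..n}"
    using that coord_bracket[OF x y, of k] by auto
  \<comment> \<open>The value 3 stands apart because its predecessor, coordinate 2, receives no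
    shifted entry; from 4 on both \<open>k\<close> and \<open>k - 1\<close> fall under the generic
    branch of \<open>rep\<close>.\<close>
  consider "k = 0 \<or> k > n" | "k = 1" | "k = 2" | "k = 3" "n \<ge> 3" | "k \<in> {4..n}" by force
  then show "rep (bracket x y) f k = (rep x (rep y f) - rep y (rep x f)) k"
  proof cases
    case 1 then show ?thesis using n by (auto simp: rep_def)
  next
    case 2 then show ?thesis using low by (simp add: rep_def)
  next
    case 3 then show ?thesis using low by (simp add: rep_def)
  next
    case 4
    then have "coord 3 (bracket x y) = coord 1 x * coord 2 y - coord 1 y * coord 2 x"
      using high by simp
    then show ?thesis using 4 low(1)
      by (simp only: rep_def minus_apply) (simp add: algebra_simps)
  next
    case 5
    have rep: "rep z h j = coord j z * h 0 + coord 1 z * h (j - 1)" "rep z h 0 = 0"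
      if "j \<in> {3..n}" for z h j
      using that by (auto simp: rep_def)
    have "k \<in> {3..n}" "k - 1 \<in> {3..n}" using 5 by auto
    then show ?thesis
      by (simp only: minus_apply rep low high)
        (simp only: algebra_simps mult_zero_left add_0_left)
  qed
qed

lemma lie_module_rep:
  assumes "n \<ge> 2"
  shows "lie_module scale g bracket seq_scale (finite_seqs n) rep"
proof -
  interpret V: vector_space seq_scale by (rule vector_space_seq)
  show ?thesis
  proof unfold_locales
    show "V.subspace (finite_seqs n)" by (rule subspace_finite_seqs)
    show "rep x v \<in> finite_seqs n" for x v using assms by (auto simp: finite_seqs_def rep_def)
    show "rep (bracket x y) v = rep x (rep y v) - rep y (rep x v)" if "x \<in> g" "y \<in> g" for x y v
      using rep_bracket_commutator assms that by blast
  qed (auto simp: rep_def fun_eq_iff seq_scale_def coord_add coord_scale algebra_simps)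
qed

lemma faithful_rep:
  assumes "n \<ge> 1"
  shows "faithful_module g (finite_seqs n) rep"
  unfolding faithful_module_def
proof (rule inj_onI)
  fix x y
  assume x: "x \<in> g" and y: "y \<in> g"
    and eq: "restrict (rep x) (finite_seqs n) = restrict (rep y) (finite_seqs n)"
  have "rep x (unit_seq j) k = rep y (unit_seq j) k" if "j \<le> n" for j k
    using fun_cong[OF eq, of "unit_seq j"] unit_seq_in[OF that] by simp
  \<comment> \<open>Discharging the premise with \<open>1 \<le> n\<close> instantiates
    \<open>j\<close> to 1, so the two test vectors are \<open>unit_seq 0\<close> and
    \<open>unit_seq 1\<close>.\<close>
  note agree = this[of 0] this[OF assms]
  show "x = y"
  proof (rule coord_eqI[OF x y])
    fix i assume "i \<in> {1..n}"
    then consider "i = 1" | "i = 2" | "i \<in> {3..n}" by force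
    then show "coord i x = coord i y"
      using agree[of i] by cases (auto simp: rep_def unit_seq_def split: if_splits)
  qed
qed

lemma not_nilpotent_rep:
  assumes "n \<ge> 1"
  shows "\<not> nilpotent_module g (finite_seqs n) rep"
proof
  assume "nilpotent_module g (finite_seqs n) rep"
  moreover have "X 1 \<in> g" using assms by (intro X_in) simp
  ultimately obtain k where "\<forall>v\<in>finite_seqs n. (rep (X 1) ^^ k) v = 0"
    unfolding nilpotent_module_def by blast
  then have "(rep (X 1) ^^ k) (unit_seq 1) 1 = 0"
    using unit_seq_in[OF assms] by (simp add: zero_fun_def)
  \<comment> \<open>Coordinate 1 of \<open>rep (X 1) f\<close> is \<open>f 1\<close> itself, so the
    induction needs to follow this one entry only.\<close>
  moreover have "(rep (X 1) ^^ m) (unit_seq 1) 1 = 1" for m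
    using assms by (induction m) (auto simp: unit_seq_def rep_def coord_X)
  ultimately show False by simp
qed

end

theorem theorem1:
  fixes n :: nat
    and scale :: "complex \<Rightarrow> 'a::ab_group_add \<Rightarrow> 'a"
    and g :: "'a set" and bracket :: "'a \<Rightarrow> 'a \<Rightarrow> 'a" and X :: "nat \<Rightarrow> 'a"
  assumes "n \<ge> 3"
    and "lie_algebra_L scale g bracket n X"
  shows "\<exists>(M :: (nat \<Rightarrow> complex) set) \<rho>.
    lie_module scale g bracket seq_scale M \<rho> \<and> fin_dim seq_scale M \<and>
    faithful_module g M \<rho> \<and> \<not> nilpotent_module g M \<rho>"
proof -
  interpret lie_algebra_L scale g bracket n X by (rule assms(2))
  have "n \<ge> 1" "n \<ge> 2" using assms(1) by auto
  then have "lie_module scale g bracket seq_scale (finite_seqs n) rep \<and>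
    fin_dim seq_scale (finite_seqs n) \<and> faithful_module g (finite_seqs n) rep \<and>
    \<not> nilpotent_module g (finite_seqs n) rep"
    by (intro conjI lie_module_rep fin_dim_finite_seqs faithful_rep not_nilpotent_rep)
  then show ?thesis by (intro exI)
qed

end
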